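(* Given a Kiepert hyperbola $\mathcal{K}$, one of the two Fermat points, and a vertex of the reference triangle on $\mathcal{K}$, we can recover (that is, construct) the other two vertices of the reference triangle.
   Context: All points lie in the real Euclidean plane. The first Fermat point $F_1$ of a triangle is obtained by erecting an equilateral triangle outwardly on each side of the triangle: the three lines joining the outer vertex of each equilateral triangle to the opposite vertex of the original triangle concur at $F_1$. The second Fermat point $F_2$ is obtained in the same way with the equilateral triangles erected inwardly on each side. The Kiepert hyperbola of a scalene triangle $ABC$ is the unique conic through the five points $A,B,C,F_1,F_2$, where $F_1,F_2$ are the first and second Fermat points of $ABC$; the triangle $ABC$ is called the reference triangle of this Kiepert hyperbola. The "two Fermat points" in the claim are those of the reference triangle. The result is an analogue of Lemoine's problem, which asks to construct a triangle given one vertex of each of the equilateral triangles placed on its sides. *)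

theory Defs
  imports "HOL-Analysis.Analysis"
begin

type_synonym plane = "real ^ 2"

abbreviation line_through :: "plane \<Rightarrow> plane \<Rightarrow> plane set" where
  "line_through P Q \<equiv> affine hull {P, Q}"

definition scalene :: "plane \<Rightarrow> plane \<Rightarrow> plane \<Rightarrow> bool" where
  "scalene A B C \<longleftrightarrow> \<not> collinear {A, B, C} \<and>
     dist A B \<noteq> dist B C \<and> dist B C \<noteq> dist C A \<and> dist C A \<noteq> dist A B"

text \<open>\<open>outer_apex A B C X\<close>: the triangle \<open>XBC\<close> is equilateral and \<open>X\<close> is separated from \<open>A\<close>
  by the line \<open>BC\<close>.  For \<open>inner_apex\<close> the points \<open>X\<close> and \<open>A\<close> are on the same side.\<close>

definition outer_apex :: "plane \<Rightarrow> plane \<Rightarrow> plane \<Rightarrow> plane \<Rightarrow> bool" where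
  "outer_apex A B C X \<longleftrightarrow> dist X B = dist B C \<and> dist X C = dist B C \<and>
     closed_segment A X \<inter> line_through B C \<noteq> {}"

definition inner_apex :: "plane \<Rightarrow> plane \<Rightarrow> plane \<Rightarrow> plane \<Rightarrow> bool" where
  "inner_apex A B C X \<longleftrightarrow> dist X B = dist B C \<and> dist X C = dist B C \<and>
     closed_segment A X \<inter> line_through B C = {}"

definition first_fermat_point :: "plane \<Rightarrow> plane \<Rightarrow> plane \<Rightarrow> plane \<Rightarrow> bool" where
  "first_fermat_point A B C F \<longleftrightarrow>
     (\<exists>X Y Z. outer_apex A B C X \<and> outer_apex B C A Y \<and> outer_apex C A B Z \<and>
        F \<in> line_through A X \<and> F \<in> line_through B Y \<and> F \<in> line_through C Z)"

definition second_fermat_point :: "plane \<Rightarrow> plane \<Rightarrow> plane \<Rightarrow> plane \<Rightarrow> bool" where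
  "second_fermat_point A B C F \<longleftrightarrow>
     (\<exists>X Y Z. inner_apex A B C X \<and> inner_apex B C A Y \<and> inner_apex C A B Z \<and>
        F \<in> line_through A X \<and> F \<in> line_through B Y \<and> F \<in> line_through C Z)"

text \<open>Degenerate conics are included, so uniqueness below is among all plane curves of degree two.\<close>

definition conic :: "plane set \<Rightarrow> bool" where
  "conic K \<longleftrightarrow> (\<exists>a b c d e f :: real. (a, b, c) \<noteq> (0, 0, 0) \<and>
     K = {p. a * (p $ 1)\<^sup>2 + b * (p $ 1) * (p $ 2) + c * (p $ 2)\<^sup>2 +
             d * (p $ 1) + e * (p $ 2) + f = 0})"

text \<open>If an angle of the triangle is 60 or 120 degrees, a Fermat point coincides with a vertex; then
  there is no unique conic through the five points and no \<open>K\<close> satisfies this predicate.\<close>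

definition kiepert_hyperbola :: "plane set \<Rightarrow> plane \<Rightarrow> plane \<Rightarrow> plane \<Rightarrow> bool" where
  "kiepert_hyperbola K A B C \<longleftrightarrow> scalene A B C \<and>
     (\<exists>F1 F2. first_fermat_point A B C F1 \<and> second_fermat_point A B C F2 \<and>
        conic K \<and> {A, B, C, F1, F2} \<subseteq> K \<and>
        (\<forall>K'. conic K' \<and> {A, B, C, F1, F2} \<subseteq> K' \<longrightarrow> K' = K))"

text \<open>Straightedge-and-compass constructions in the presence of a given curve \<open>K\<close>.  Points are
  referred to by their index in the list of points available so far.  \<open>Line i j\<close> joins the points
  \<open>i\<close> and \<open>j\<close>; \<open>Circle i j\<close> has centre \<open>i\<close> and passes through \<open>j\<close>.  A step adds one common point
  of two drawn figures (\<open>Meet\<close>), or of a drawn line and the given curve (\<open>Meet_Given\<close>), other than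
  the already available points whose indices are listed in its last argument.  Circles are not
  intersected with the curve: that would in general exceed straightedge and compass, whereas
  the intersection of a line with a conic is always constructible by these instruments.\<close>

datatype figure = Line nat nat | Circle nat nat

datatype step = Meet figure figure "nat list" | Meet_Given nat nat "nat list"

fun drawable :: "plane list \<Rightarrow> figure \<Rightarrow> bool" where
  "drawable ps (Line i j) \<longleftrightarrow> i < length ps \<and> j < length ps \<and> ps ! i \<noteq> ps ! j"
| "drawable ps (Circle i j) \<longleftrightarrow> i < length ps \<and> j < length ps \<and> ps ! i \<noteq> ps ! j"

fun drawn :: "plane list \<Rightarrow> figure \<Rightarrow> plane set" where
  "drawn ps (Line i j) = line_through (ps ! i) (ps ! j)"
| "drawn ps (Circle i j) = sphere (ps ! i) (dist (ps ! i) (ps ! j))"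

text \<open>Finiteness of the intersection rules out picking arbitrary points on a common component.\<close>

fun legal_step :: "plane set \<Rightarrow> plane list \<Rightarrow> step \<Rightarrow> bool" where
  "legal_step K ps (Meet g h ks) \<longleftrightarrow> drawable ps g \<and> drawable ps h \<and>
     finite (drawn ps g \<inter> drawn ps h) \<and> (\<forall>k \<in> set ks. k < length ps)"
| "legal_step K ps (Meet_Given i j ks) \<longleftrightarrow> drawable ps (Line i j) \<and>
     finite (drawn ps (Line i j) \<inter> K) \<and> (\<forall>k \<in> set ks. k < length ps)"

fun candidates :: "plane set \<Rightarrow> plane list \<Rightarrow> step \<Rightarrow> plane set" where
  "candidates K ps (Meet g h ks) = drawn ps g \<inter> drawn ps h - {ps ! k | k. k \<in> set ks}"
| "candidates K ps (Meet_Given i j ks) = drawn ps (Line i j) \<inter> K - {ps ! k | k. k \<in> set ks}"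

text \<open>\<open>achieves K steps ps Q\<close>: started from the points \<open>ps\<close>, every step can be carried out, and
  whichever of the admissible intersection points is chosen at each step, the final list of points
  satisfies \<open>Q\<close>.\<close>

fun achieves :: "plane set \<Rightarrow> step list \<Rightarrow> plane list \<Rightarrow> (plane list \<Rightarrow> bool) \<Rightarrow> bool" where
  "achieves K [] ps Q \<longleftrightarrow> Q ps"
| "achieves K (s # ss) ps Q \<longleftrightarrow> legal_step K ps s \<and> candidates K ps s \<noteq> {} \<and>
     (\<forall>x \<in> candidates K ps s. achieves K ss (ps @ [x]) Q)"

end

theory Submission
  imports Defs
begin

text \<open>The lines joining a Fermat point \<open>F\<close> to the vertices make angles of 60 degrees with each other,
  and a line meets a conic that does not contain it in at most two points.  So \<open>B\<close> and \<open>C\<close> are the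
  second intersections of \<open>K\<close> with the two lines through \<open>F\<close> at 60 degrees to \<open>FA\<close>; these lines pass
  through the two common points of the circles about \<open>F\<close> and \<open>A\<close> with radius \<open>FA\<close>.

  Uniqueness of the conic forces \<open>F\<close> to differ from the vertices.  If \<open>K\<close> contained the line \<open>FB\<close>, then
  the other Fermat point \<open>G\<close> would lie on \<open>FB\<close> or on \<open>AC\<close>.  In the first case \<open>B\<close> and both apices over
  \<open>AC\<close> are collinear, so \<open>B\<close> is on the perpendicular bisector of \<open>AC\<close> and the triangle is isosceles;
  in the second the lines \<open>GA\<close> and \<open>GC\<close> coincide, although they meet at 60 degrees.\<close>

section \<open>Vectors, lines and orientation in the plane\<close>

definition cross :: "plane \<Rightarrow> plane \<Rightarrow> real" where
  "cross u v = u $ 1 * v $ 2 - u $ 2 * v $ 1"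

definition perp :: "plane \<Rightarrow> plane" where
  "perp v = vector [- v $ 2, v $ 1]"

text \<open>The triangle with base \<open>BC\<close> and this apex is equilateral for \<open>c = sqrt 3 / 2\<close> and
  \<open>c = - sqrt 3 / 2\<close>; the sign selects the side of \<open>BC\<close>.\<close>

definition apex :: "real \<Rightarrow> plane \<Rightarrow> plane \<Rightarrow> plane" where
  "apex c B C = (1/2) *\<^sub>R (B + C) + c *\<^sub>R perp (C - B)"

text \<open>One parameter, \<open>c = sqrt 3 / 2\<close> or \<open>c = - (sqrt 3 / 2)\<close>,
  treats both Fermat points at once; which sign belongs to the first one depends on the orientation
  of the triangle. The sides are taken in cyclic order so that the same \<open>c\<close> serves all
  three apexes.\<close>

definition fermat :: "real \<Rightarrow> plane \<Rightarrow> plane \<Rightarrow> plane \<Rightarrow> plane \<Rightarrow> bool" where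
  "fermat c A B C F \<longleftrightarrow> F \<in> line_through A (apex c B C) \<and> F \<in> line_through B (apex c C A) \<and>
     F \<in> line_through C (apex c A B)"

lemma plane_eq_iff: "(u :: plane) = v \<longleftrightarrow> u $ 1 = v $ 1 \<and> u $ 2 = v $ 2"
  by (simp add: vec_eq_iff forall_2)

lemma perp_nth [simp]: "perp v $ 1 = - v $ 2" "perp v $ 2 = v $ 1"
  by (simp_all add: perp_def)

lemma apex_nth [simp]:
  "apex c B C $ 1 = (B $ 1 + C $ 1) / 2 - c * (C $ 2 - B $ 2)"
  "apex c B C $ 2 = (B $ 2 + C $ 2) / 2 + c * (C $ 1 - B $ 1)"
  by (simp_all add: apex_def algebra_simps)

lemma dist_plane: "dist (u :: plane) v = sqrt ((u $ 1 - v $ 1)\<^sup>2 + (u $ 2 - v $ 2)\<^sup>2)"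
  by (simp add: dist_norm norm_vec_def L2_set_def sum_2)

lemma dist_plane_eq_iff:
  "dist (u :: plane) v = dist w (z :: plane) \<longleftrightarrow>
     (u $ 1 - v $ 1)\<^sup>2 + (u $ 2 - v $ 2)\<^sup>2 = (w $ 1 - z $ 1)\<^sup>2 + (w $ 2 - z $ 2)\<^sup>2"
  by (simp add: dist_plane)

lemma sum_squares_plane_pos: "(u :: plane) \<noteq> 0 \<Longrightarrow> (u $ 1)\<^sup>2 + (u $ 2)\<^sup>2 > 0"
  by (simp add: plane_eq_iff sum_power2_gt_zero_iff)

lemma cross_zero_parallel:
  assumes "cross d p = 0" and "d \<noteq> 0"
  shows "\<exists>t. p = t *\<^sub>R d"
proof -
  have "d $ 1 \<noteq> 0 \<or> d $ 2 \<noteq> 0" using assms(2) by (simp add: plane_eq_iff)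
  then show ?thesis
  proof
    assume "d $ 1 \<noteq> 0"
    with assms(1) have "p = (p $ 1 / d $ 1) *\<^sub>R d"
      by (simp add: plane_eq_iff cross_def field_simps)
    then show ?thesis ..
  next
    assume "d $ 2 \<noteq> 0"
    with assms(1) have "p = (p $ 2 / d $ 2) *\<^sub>R d"
      by (simp add: plane_eq_iff cross_def field_simps)
    then show ?thesis ..
  qed
qed

lemma in_line_through: "p \<in> line_through P Q \<longleftrightarrow> (\<exists>t. p = P + t *\<^sub>R (Q - P))"
  by (auto simp: affine_hull_2_alt)

lemma in_line_through_iff_cross:
  assumes "P \<noteq> Q"
  shows "p \<in> line_through P Q \<longleftrightarrow> cross (Q - P) (p - P) = 0"
proof
  assume "p \<in> line_through P Q"
  then show "cross (Q - P) (p - P) = 0" by (auto simp: in_line_through cross_def)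
next
  assume "cross (Q - P) (p - P) = 0"
  then obtain t where "p - P = t *\<^sub>R (Q - P)"
    using cross_zero_parallel[of "Q - P" "p - P"] assms by auto
  then have "p = P + t *\<^sub>R (Q - P)" by (simp add: algebra_simps)
  then show "p \<in> line_through P Q" unfolding in_line_through ..
qed

lemma collinear_iff_cross: "collinear {A, B, C :: plane} \<longleftrightarrow> cross (B - A) (C - A) = 0"
proof (cases "A = B")
  case True
  then show ?thesis by (simp add: cross_def)
next
  case False
  have "collinear {A, B, C} \<longleftrightarrow> C \<in> line_through A B"
    using False by (simp add: collinear_3_affine_hull)
  then show ?thesis using in_line_through_iff_cross[OF False] by simp
qed

lemma cross_cyclic: "cross (C - B) (A - B) = cross (B - A) (C - A)"
  by (simp add: cross_def algebra_simps)

section \<open>Apexes of equilateral triangles on a side\<close>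

lemma dist_apex:
  assumes "c\<^sup>2 = 3/4"
  shows "dist (apex c B C) B = dist B C" "dist (apex c B C) C = dist B C"
proof -
  have "(apex c B C $ 1 - B $ 1)\<^sup>2 + (apex c B C $ 2 - B $ 2)\<^sup>2 =
      (1/4 + c\<^sup>2) * ((B $ 1 - C $ 1)\<^sup>2 + (B $ 2 - C $ 2)\<^sup>2)"
    "(apex c B C $ 1 - C $ 1)\<^sup>2 + (apex c B C $ 2 - C $ 2)\<^sup>2 =
      (1/4 + c\<^sup>2) * ((B $ 1 - C $ 1)\<^sup>2 + (B $ 2 - C $ 2)\<^sup>2)"
    by (simp_all add: power2_eq_square field_simps)
  then show "dist (apex c B C) B = dist B C" "dist (apex c B C) C = dist B C"
    unfolding dist_plane_eq_iff assms by simp_all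
qed

lemma equidistant_iff_apex:
  assumes "B \<noteq> C"
  shows "dist X B = dist B C \<and> dist X C = dist B C \<longleftrightarrow>
    X = apex (sqrt 3 / 2) B C \<or> X = apex (- (sqrt 3 / 2)) B C"
proof
  assume "dist X B = dist B C \<and> dist X C = dist B C"
  then have e: "(X $ 1 - B $ 1)\<^sup>2 + (X $ 2 - B $ 2)\<^sup>2 = (B $ 1 - C $ 1)\<^sup>2 + (B $ 2 - C $ 2)\<^sup>2"
    "(X $ 1 - C $ 1)\<^sup>2 + (X $ 2 - C $ 2)\<^sup>2 = (B $ 1 - C $ 1)\<^sup>2 + (B $ 2 - C $ 2)\<^sup>2"
    by (simp_all add: dist_plane_eq_iff)
  define W where "W = X - (1/2) *\<^sub>R (B + C)"
  have W: "W $ 1 = X $ 1 - (B $ 1 + C $ 1) / 2" "W $ 2 = X $ 2 - (B $ 2 + C $ 2) / 2"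
    by (simp_all add: W_def)
  \<comment> \<open>The difference of the two equations in \<open>e\<close> puts \<open>X\<close> on
    the perpendicular bisector of \<open>BC\<close>, so \<open>W\<close>, measured from the
    midpoint, is orthogonal to \<open>C - B\<close>.\<close>
  have "cross (perp (C - B)) W = 0"
    using e by (simp add: W cross_def power2_eq_square field_simps)
  moreover have "perp (C - B) \<noteq> 0" using assms by (auto simp: plane_eq_iff)
  ultimately obtain k where k: "W = k *\<^sub>R perp (C - B)"
    using cross_zero_parallel by blast
  have X: "X = apex k B C" using k by (simp add: apex_def W_def algebra_simps)
  have "(1/4 + k\<^sup>2) * ((B $ 1 - C $ 1)\<^sup>2 + (B $ 2 - C $ 2)\<^sup>2) = (B $ 1 - C $ 1)\<^sup>2 + (B $ 2 - C $ 2)\<^sup>2"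
    using e(1) unfolding X apex_nth by (simp add: power2_eq_square field_simps)
  moreover have "(B $ 1 - C $ 1)\<^sup>2 + (B $ 2 - C $ 2)\<^sup>2 \<noteq> 0"
    using sum_squares_plane_pos[of "B - C"] assms by auto
  ultimately have "1/4 + k\<^sup>2 = 1" by (metis mult_cancel_right1)
  then have "k\<^sup>2 = (sqrt 3 / 2)\<^sup>2" by (simp add: power_divide)
  then have "k = sqrt 3 / 2 \<or> k = - (sqrt 3 / 2)" by (simp only: power2_eq_iff)
  with X show "X = apex (sqrt 3 / 2) B C \<or> X = apex (- (sqrt 3 / 2)) B C" by blast
next
  assume "X = apex (sqrt 3 / 2) B C \<or> X = apex (- (sqrt 3 / 2)) B C"
  then show "dist X B = dist B C \<and> dist X C = dist B C"
    using dist_apex[of "sqrt 3 / 2"] dist_apex[of "- (sqrt 3 / 2)"] by (auto simp: power_divide)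
qed

lemma cross_apex: "cross (C - B) (apex c B C - B) = c * ((C $ 1 - B $ 1)\<^sup>2 + (C $ 2 - B $ 2)\<^sup>2)"
  by (simp add: cross_def power2_eq_square field_simps)

lemma cross_convex_comb:
  "cross d (((1 - u) *\<^sub>R A + u *\<^sub>R X) - B) = (1 - u) * cross d (A - B) + u * cross d (X - B)"
  by (simp add: cross_def algebra_simps)

text \<open>The map \<open>p\<close> to \<open>cross (C - B) (p - B)\<close> vanishes exactly on the
  line and is affine along the segment, with end values \<open>D\<close> at \<open>A\<close> and
  \<open>c * S\<close>, \<open>S > 0\<close>, at the apex. It has a zero on the segment iff these
  nonzero values have opposite signs.\<close>

lemma segment_meets_line_iff:
  assumes "B \<noteq> C" and "c \<noteq> 0" and D: "cross (C - B) (A - B) \<noteq> 0"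
  shows "closed_segment A (apex c B C) \<inter> line_through B C \<noteq> {} \<longleftrightarrow>
    c * cross (C - B) (A - B) < 0"
proof -
  define D where "D = cross (C - B) (A - B)"
  define E where "E = cross (C - B) (apex c B C - B)"
  define S where "S = (C $ 1 - B $ 1)\<^sup>2 + (C $ 2 - B $ 2)\<^sup>2"
  have S: "S > 0" using sum_squares_plane_pos[of "C - B"] assms(1) by (simp add: S_def)
  have E: "E = c * S" unfolding E_def S_def by (rule cross_apex)
  have "closed_segment A (apex c B C) \<inter> line_through B C \<noteq> {} \<longleftrightarrow>
      (\<exists>u. 0 \<le> u \<and> u \<le> 1 \<and> (1 - u) * D + u * E = 0)"
    unfolding D_def E_def cross_convex_comb[symmetric]
    using in_line_through_iff_cross[OF assms(1)] by (auto simp: closed_segment_def)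
  also have "\<dots> \<longleftrightarrow> D * E < 0"
  proof
    assume "\<exists>u. 0 \<le> u \<and> u \<le> 1 \<and> (1 - u) * D + u * E = 0"
    then obtain u where u: "0 \<le> u" "u \<le> 1" "(1 - u) * D + u * E = 0" by blast
    have nz: "D \<noteq> 0" "E \<noteq> 0" using D S E assms(2) by (auto simp: D_def)
    show "D * E < 0"
    proof (rule ccontr)
      assume "\<not> D * E < 0"
      then have pos: "D * E > 0" using nz by (simp add: less_le)
      \<comment> \<open>Multiplying the equation by \<open>D\<close> makes both summands
        nonnegative; they cannot both be zero.\<close>
      have "(1 - u) * D\<^sup>2 + u * (D * E) = D * ((1 - u) * D + u * E)"
        by (simp add: power2_eq_square algebra_simps)
      then have "(1 - u) * D\<^sup>2 + u * (D * E) = 0" using u(3) by simp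
      moreover have "(1 - u) * D\<^sup>2 \<ge> 0" "u * (D * E) \<ge> 0" using u pos by auto
      ultimately have "(1 - u) * D\<^sup>2 = 0" "u * (D * E) = 0" by linarith+
      then show False using nz by auto
    qed
  next
    assume DE: "D * E < 0"
    then have ne: "D - E \<noteq> 0" by auto
    have "0 \<le> D / (D - E)" "D / (D - E) \<le> 1"
      using DE by (auto simp: mult_less_0_iff divide_simps)
    moreover have "(1 - D / (D - E)) * D + D / (D - E) * E = 0"
      using ne by (simp add: field_simps)
    ultimately show "\<exists>u. 0 \<le> u \<and> u \<le> 1 \<and> (1 - u) * D + u * E = 0" by blast
  qed
  also have "D * E < 0 \<longleftrightarrow> c * D < 0"
    using S unfolding E by (auto simp: mult_less_0_iff zero_less_mult_iff)
  finally show ?thesis by (simp add: D_def)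
qed

text \<open>Only two points complete \<open>BC\<close> to an equilateral triangle, and the segment
  from \<open>A\<close> crosses \<open>BC\<close> for the one whose parameter has the sign opposite
  to the orientation of the triangle.\<close>

lemma outer_apex_eq:
  assumes D: "cross (B - A) (C - A) \<noteq> 0" and "outer_apex A B C X"
  shows "X = apex (- sgn (cross (B - A) (C - A)) * (sqrt 3 / 2)) B C"
proof -
  have ne: "B \<noteq> C" using D by (auto simp: cross_def)
  have seg: "closed_segment A (apex c B C) \<inter> line_through B C \<noteq> {} \<longleftrightarrow>
      c * cross (B - A) (C - A) < 0" if "c \<noteq> 0" for c
    using segment_meets_line_iff[OF ne that, of A] D unfolding cross_cyclic[of C B A] by blast
  from seg[of "sqrt 3 / 2"] seg[of "- (sqrt 3 / 2)"]
  have seg: "closed_segment A (apex (sqrt 3 / 2) B C) \<inter> line_through B C \<noteq> {} \<longleftrightarrow>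
      cross (B - A) (C - A) < 0"
    "closed_segment A (apex (- (sqrt 3 / 2)) B C) \<inter> line_through B C \<noteq> {} \<longleftrightarrow>
      cross (B - A) (C - A) > 0"
    by (auto simp: mult_less_0_iff zero_less_mult_iff)
  have "X = apex (sqrt 3 / 2) B C \<or> X = apex (- (sqrt 3 / 2)) B C"
    using assms(2) equidistant_iff_apex[OF ne] by (auto simp: outer_apex_def)
  then show ?thesis
    using seg assms(2) D unfolding outer_apex_def
    by (cases "cross (B - A) (C - A)" "0 :: real" rule: linorder_cases)
       (auto simp: mult_less_0_iff)
qed

lemma inner_apex_eq:
  assumes D: "cross (B - A) (C - A) \<noteq> 0" and "inner_apex A B C X"
  shows "X = apex (sgn (cross (B - A) (C - A)) * (sqrt 3 / 2)) B C"
proof -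
  have ne: "B \<noteq> C" using D by (auto simp: cross_def)
  have seg: "closed_segment A (apex c B C) \<inter> line_through B C \<noteq> {} \<longleftrightarrow>
      c * cross (B - A) (C - A) < 0" if "c \<noteq> 0" for c
    using segment_meets_line_iff[OF ne that, of A] D unfolding cross_cyclic[of C B A] by blast
  from seg[of "sqrt 3 / 2"] seg[of "- (sqrt 3 / 2)"]
  have seg: "closed_segment A (apex (sqrt 3 / 2) B C) \<inter> line_through B C \<noteq> {} \<longleftrightarrow>
      cross (B - A) (C - A) < 0"
    "closed_segment A (apex (- (sqrt 3 / 2)) B C) \<inter> line_through B C \<noteq> {} \<longleftrightarrow>
      cross (B - A) (C - A) > 0"
    by (auto simp: mult_less_0_iff zero_less_mult_iff)
  have "X = apex (sqrt 3 / 2) B C \<or> X = apex (- (sqrt 3 / 2)) B C"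
    using assms(2) equidistant_iff_apex[OF ne] by (auto simp: inner_apex_def)
  then show ?thesis
    using seg assms(2) D unfolding inner_apex_def
    by (cases "cross (B - A) (C - A)" "0 :: real" rule: linorder_cases)
       (auto simp: mult_less_0_iff)
qed

section \<open>The two Fermat points as instances of \<open>fermat\<close>\<close>

lemma first_fermat_point_imp_fermat:
  assumes D: "cross (B - A) (C - A) \<noteq> 0" and "first_fermat_point A B C F"
  shows "fermat (- sgn (cross (B - A) (C - A)) * (sqrt 3 / 2)) A B C F"
proof -
  obtain X Y Z where XYZ: "outer_apex A B C X" "outer_apex B C A Y" "outer_apex C A B Z"
    and F: "F \<in> line_through A X" "F \<in> line_through B Y" "F \<in> line_through C Z"
    using assms(2) unfolding first_fermat_point_def by blast
  \<comment> \<open>Cyclic shifts preserve the orientation, so the three outer apexes share one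
    parameter.\<close>
  have D': "cross (C - B) (A - B) = cross (B - A) (C - A)" "cross (A - C) (B - C) = cross (B - A) (C - A)"
    by (simp_all add: cross_def algebra_simps)
  show ?thesis
    using F outer_apex_eq[OF _ XYZ(1)] outer_apex_eq[OF _ XYZ(2)] outer_apex_eq[OF _ XYZ(3)] D
    unfolding fermat_def D' by simp
qed

lemma second_fermat_point_imp_fermat:
  assumes D: "cross (B - A) (C - A) \<noteq> 0" and "second_fermat_point A B C F"
  shows "fermat (sgn (cross (B - A) (C - A)) * (sqrt 3 / 2)) A B C F"
proof -
  obtain X Y Z where XYZ: "inner_apex A B C X" "inner_apex B C A Y" "inner_apex C A B Z"
    and F: "F \<in> line_through A X" "F \<in> line_through B Y" "F \<in> line_through C Z"
    using assms(2) unfolding second_fermat_point_def by blast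
  have D': "cross (C - B) (A - B) = cross (B - A) (C - A)" "cross (A - C) (B - C) = cross (B - A) (C - A)"
    by (simp_all add: cross_def algebra_simps)
  show ?thesis
    using F inner_apex_eq[OF _ XYZ(1)] inner_apex_eq[OF _ XYZ(2)] inner_apex_eq[OF _ XYZ(3)] D
    unfolding fermat_def D' by simp
qed

lemma fermat_rotate: "fermat c A B C F \<Longrightarrow> fermat c B C A F"
  by (simp add: fermat_def)

lemma apex_swap: "apex (- c) C B = apex c B C"
  by (simp add: plane_eq_iff algebra_simps)

text \<open>Interchanging \<open>B\<close> and \<open>C\<close> reverses the orientation. This
  carries results about the vertex \<open>B\<close> over to \<open>C\<close>.\<close>

lemma fermat_swap: "fermat c A B C F \<Longrightarrow> fermat (- c) A C B F"
  by (simp add: fermat_def apex_swap)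

section \<open>Angles between the lines through a Fermat point\<close>

text \<open>With \<open>c\<^sup>2 = 3/4\<close> the map \<open>u\<close> to
  \<open>(1/2) *\<^sub>R u + c *\<^sub>R perp u\<close> is a rotation by 60 degrees, its sense given
  by the sign of \<open>c\<close>. This is the classical fact that the segments from the vertices to
  the opposite apexes have equal length and make angles of 60 degrees.\<close>

lemma fermat_lines_rotation:
  assumes c: "c\<^sup>2 = 3/4"
  shows "apex c C A - B = - ((1/2) *\<^sub>R (apex c B C - A) + c *\<^sub>R perp (apex c B C - A))"
proof -
  have 1: "(apex c C A - B) $ 1 + (apex c B C - A) $ 1 / 2 - c * (apex c B C - A) $ 2 =
      (c\<^sup>2 - 3/4) * (B $ 1 - C $ 1)"
    "(apex c C A - B) $ 2 + (apex c B C - A) $ 2 / 2 + c * (apex c B C - A) $ 1 =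
      (c\<^sup>2 - 3/4) * (B $ 2 - C $ 2)"
    by (simp_all add: power2_eq_square field_simps)
  show ?thesis using 1 unfolding c plane_eq_iff by (simp add: field_simps del: apex_nth)
qed

lemma cross_fermat_lines:
  assumes c: "c\<^sup>2 = 3/4"
  shows "cross (apex c B C - A) (apex c C A - B) =
    - c * ((apex c B C $ 1 - A $ 1)\<^sup>2 + (apex c B C $ 2 - A $ 2)\<^sup>2)"
proof -
  have "cross u (- ((1/2) *\<^sub>R u + c *\<^sub>R perp u)) = - c * ((u $ 1)\<^sup>2 + (u $ 2)\<^sup>2)" for u
    by (simp add: cross_def power2_eq_square algebra_simps)
  from this[of "apex c B C - A"] show ?thesis
    by (simp only: fermat_lines_rotation[OF c, of C A B, symmetric] vector_minus_component)
qed

lemma apex_neq_vertex: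
  assumes c: "c\<^sup>2 = 3/4" and "scalene A B C"
  shows "apex c B C \<noteq> A"
proof
  assume A: "apex c B C = A"
  with dist_apex(1)[OF c, of B C] assms(2) show False by (simp add: scalene_def)
qed

lemma cross_fermat_lines_neq_0:
  assumes c: "c\<^sup>2 = 3/4" and "scalene A B C"
  shows "cross (apex c B C - A) (apex c C A - B) \<noteq> 0"
proof -
  have "c \<noteq> 0" using c by auto
  moreover have "(apex c B C $ 1 - A $ 1)\<^sup>2 + (apex c B C $ 2 - A $ 2)\<^sup>2 \<noteq> 0"
    using sum_squares_plane_pos[of "apex c B C - A"] apex_neq_vertex[OF assms] by auto
  ultimately show ?thesis unfolding cross_fermat_lines[OF c] by simp
qed

lemma scalene_rotate: "scalene A B C \<Longrightarrow> scalene B C A"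
  by (auto simp: scalene_def insert_commute)

lemma scalene_swap: "scalene A B C \<Longrightarrow> scalene A C B"
  by (auto simp: scalene_def insert_commute dist_commute)

text \<open>\<open>F - G\<close> is parallel to two lines that are not parallel to each other. This
  identifies a given Fermat point with the one that occurs in
  \<open>kiepert_hyperbola\<close>.\<close>

lemma fermat_unique:
  assumes c: "c\<^sup>2 = 3/4" and sc: "scalene A B C" and "fermat c A B C F" "fermat c A B C G"
  shows "F = G"
proof -
  define u where "u = apex c B C - A"
  define v where "v = apex c C A - B"
  have uv: "cross u v \<noteq> 0"
    unfolding u_def v_def by (rule cross_fermat_lines_neq_0[OF c sc])
  obtain t t' r r' where "F = A + t *\<^sub>R u" "G = A + t' *\<^sub>R u" "F = B + r *\<^sub>R v" "G = B + r' *\<^sub>R v"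
    using assms(3,4) unfolding fermat_def in_line_through u_def v_def by blast
  then have 1: "F - G = (t - t') *\<^sub>R u" and 2: "F - G = (r - r') *\<^sub>R v"
    by (metis add_diff_cancel_left scaleR_left_diff_distrib)+
  have "cross (F - G) v = (t - t') * cross u v" unfolding 1 by (simp add: cross_def algebra_simps)
  moreover have "cross (F - G) v = 0" unfolding 2 by (simp add: cross_def)
  ultimately show ?thesis using uv 1 by simp
qed

section \<open>Line pairs and the uniqueness of conics\<close>

lemma conic_line_pair:
  assumes "d \<noteq> 0" "e \<noteq> 0"
  shows "conic {p. cross d (p - P) * cross e (p - Q) = 0}"
proof -
  let ?m = "d $ 2 * P $ 1 - d $ 1 * P $ 2" and ?n = "e $ 2 * Q $ 1 - e $ 1 * Q $ 2"
  have "cross d (p - P) * cross e (p - Q) =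
      d $ 2 * e $ 2 * (p $ 1)\<^sup>2 + - (d $ 1 * e $ 2 + d $ 2 * e $ 1) * p $ 1 * p $ 2
      + d $ 1 * e $ 1 * (p $ 2)\<^sup>2 + - (d $ 2 * ?n + e $ 2 * ?m) * p $ 1
      + (d $ 1 * ?n + e $ 1 * ?m) * p $ 2 + ?m * ?n" for p
    by (simp add: cross_def power2_eq_square algebra_simps)
  \<comment> \<open>These are the coefficients of a product of two nonzero linear forms.\<close>
  moreover have "(d $ 2 * e $ 2, - (d $ 1 * e $ 2 + d $ 2 * e $ 1), d $ 1 * e $ 1) \<noteq> (0, 0, 0)"
    using assms by (auto simp: plane_eq_iff)
  ultimately show ?thesis unfolding conic_def by (simp only:) blast
qed

text \<open>The line \<open>AB\<close> together with a line through \<open>C\<close> and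
  \<open>P\<close> is a degenerate conic through the four points, so uniqueness identifies it with
  \<open>K\<close>.\<close>

lemma side_subset_unique_conic:
  assumes "A \<noteq> B" and "\<And>K'. conic K' \<Longrightarrow> {A, B, C, P} \<subseteq> K' \<Longrightarrow> K' = K"
  obtains e where "e \<noteq> 0" "K = {p. cross (B - A) (p - A) * cross e (p - C) = 0}"
proof -
  obtain e :: plane where e: "e \<noteq> 0" "cross e (P - C) = 0"
  proof (cases "P = C")
    case True
    \<comment> \<open>For \<open>P = C\<close> every direction is allowed; \<open>B - A\<close> is
      just a nonzero one.\<close>
    then show ?thesis using that[of "B - A"] assms(1) by (simp add: cross_def)
  next
    case False
    then show ?thesis using that[of "P - C"] by (simp add: cross_def)
  qed
  have "{p. cross (B - A) (p - A) * cross e (p - C) = 0} = K"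
  proof (rule assms(2))
    show "conic {p. cross (B - A) (p - A) * cross e (p - C) = 0}"
      using assms(1) e(1) by (intro conic_line_pair) auto
    show "{A, B, C, P} \<subseteq> {p. cross (B - A) (p - A) * cross e (p - C) = 0}"
      using e(2) by (auto simp: cross_def)
  qed
  with e that show ?thesis by blast
qed

text \<open>A unique conic would be equal to three line pairs, each made of a side and a line through the
  opposite vertex and \<open>P\<close>, hence contain all three sides.\<close>

lemma no_unique_conic_through_four_points:
  assumes D: "cross (B - A) (C - A) \<noteq> 0"
  shows "\<not> (\<forall>K'. conic K' \<and> {A, B, C, P} \<subseteq> K' \<longrightarrow> K' = K)"
proof
  assume K: "\<forall>K'. conic K' \<and> {A, B, C, P} \<subseteq> K' \<longrightarrow> K' = K"
  have ne: "A \<noteq> B" "B \<noteq> C" "C \<noteq> A" using D by (auto simp: cross_def)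
  obtain e where e: "e \<noteq> 0" "K = {p. cross (B - A) (p - A) * cross e (p - C) = 0}"
    using side_subset_unique_conic[OF ne(1), of C P K] K by blast
  obtain f where f: "K = {p. cross (C - B) (p - B) * cross f (p - A) = 0}"
    using side_subset_unique_conic[OF ne(2), of A P K] K by (metis insert_commute)
  obtain g where g: "K = {p. cross (A - C) (p - C) * cross g (p - B) = 0}"
    using side_subset_unique_conic[OF ne(3), of B P K] K by (metis insert_commute)
  \<comment> \<open>The midpoint of \<open>BC\<close> is in \<open>K\<close> but off the line
    \<open>AB\<close>, hence on the second line of the first pair. The same is done with the
    midpoint of \<open>AC\<close>.\<close>
  have "(1/2) *\<^sub>R (B + C) \<in> K" unfolding f by (simp add: cross_def field_simps)
  moreover have "cross (B - A) ((1/2) *\<^sub>R (B + C) - A) \<noteq> 0"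
    using D by (simp add: cross_def field_simps)
  ultimately have 1: "cross e ((1/2) *\<^sub>R (B + C) - C) = 0" unfolding e by simp
  have "(1/2) *\<^sub>R (A + C) \<in> K" unfolding g by (simp add: cross_def field_simps)
  moreover have "cross (B - A) ((1/2) *\<^sub>R (A + C) - A) \<noteq> 0"
    using D by (simp add: cross_def field_simps)
  ultimately have 2: "cross e ((1/2) *\<^sub>R (A + C) - C) = 0" unfolding e by simp
  \<comment> \<open>Now \<open>e\<close> is parallel to both \<open>B - C\<close> and
    \<open>A - C\<close>, which are independent.\<close>
  have "e $ 1 * cross (B - A) (C - A) = 0" "e $ 2 * cross (B - A) (C - A) = 0"
    using 1 2 unfolding cross_def by (simp_all, algebra+)
  with D e(1) show False by (simp add: plane_eq_iff)
qed

section \<open>Intersection of a conic with a line\<close>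

text \<open>In coordinates with origin \<open>F\<close> and axes \<open>v\<close> and
  \<open>perp v\<close>, the line through \<open>F\<close> in direction \<open>v\<close> becomes
  \<open>y = 0\<close>, and only \<open>a'\<close>, \<open>d'\<close>, \<open>f'\<close> matter on
  it.\<close>

lemma quadratic_in_rotated_coordinates:
  fixes a b c d e f :: real and F v :: plane
  obtains a' b' c' d' e' f' where "\<And>x y p. p = F + x *\<^sub>R v + y *\<^sub>R perp v \<Longrightarrow>
    a * (p $ 1)\<^sup>2 + b * (p $ 1) * (p $ 2) + c * (p $ 2)\<^sup>2 + d * (p $ 1) + e * (p $ 2) + f =
    a' * x\<^sup>2 + b' * x * y + c' * y\<^sup>2 + d' * x + e' * y + f'"
proof (rule that)
  fix x y :: real and p :: plane
  assume p: "p = F + x *\<^sub>R v + y *\<^sub>R perp v"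
  show "a * (p $ 1)\<^sup>2 + b * (p $ 1) * (p $ 2) + c * (p $ 2)\<^sup>2 + d * (p $ 1) + e * (p $ 2) + f =
    (a * (v $ 1)\<^sup>2 + b * v $ 1 * v $ 2 + c * (v $ 2)\<^sup>2) * x\<^sup>2 +
    (- 2 * a * v $ 1 * v $ 2 + b * ((v $ 1)\<^sup>2 - (v $ 2)\<^sup>2) + 2 * c * v $ 1 * v $ 2) * x * y +
    (a * (v $ 2)\<^sup>2 - b * v $ 1 * v $ 2 + c * (v $ 1)\<^sup>2) * y\<^sup>2 +
    (2 * a * F $ 1 * v $ 1 + b * (F $ 1 * v $ 2 + F $ 2 * v $ 1) + 2 * c * F $ 2 * v $ 2
      + d * v $ 1 + e * v $ 2) * x +
    (- 2 * a * F $ 1 * v $ 2 + b * (F $ 1 * v $ 1 - F $ 2 * v $ 2) + 2 * c * F $ 2 * v $ 1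
      - d * v $ 2 + e * v $ 1) * y +
    (a * (F $ 1)\<^sup>2 + b * F $ 1 * F $ 2 + c * (F $ 2)\<^sup>2 + d * F $ 1 + e * F $ 2 + f)"
    unfolding p by (simp add: power2_eq_square algebra_simps)
qed

lemma rotated_coordinates_exist:
  assumes "v \<noteq> 0"
  obtains x y where "p = F + x *\<^sub>R v + y *\<^sub>R perp v"
proof -
  define N where "N = (v $ 1)\<^sup>2 + (v $ 2)\<^sup>2"
  have N: "N \<noteq> 0" using sum_squares_plane_pos[OF assms] unfolding N_def by linarith
  \<comment> \<open>The orthogonal projections of \<open>p - F\<close> to \<open>v\<close> and
    \<open>perp v\<close>, divided by the squared length \<open>N\<close> of these vectors.\<close>
  define x y where "x = (v $ 1 * (p $ 1 - F $ 1) + v $ 2 * (p $ 2 - F $ 2)) / N"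
    and "y = cross v (p - F) / N"
  have xy: "N * x = v $ 1 * (p $ 1 - F $ 1) + v $ 2 * (p $ 2 - F $ 2)"
    "N * y = v $ 1 * (p $ 2 - F $ 2) - v $ 2 * (p $ 1 - F $ 1)"
    using N by (simp_all add: x_def y_def cross_def)
  have "N * (p $ 1 - F $ 1) = (N * x) * v $ 1 - (N * y) * v $ 2"
    "N * (p $ 2 - F $ 2) = (N * x) * v $ 2 + (N * y) * v $ 1"
    unfolding xy by (simp_all add: N_def power2_eq_square algebra_simps)
  then have "N * (p $ 1 - F $ 1) = N * (x * v $ 1 - y * v $ 2)"
    "N * (p $ 2 - F $ 2) = N * (x * v $ 2 + y * v $ 1)"
    by (simp_all add: algebra_simps)
  then have "p $ 1 - F $ 1 = x * v $ 1 - y * v $ 2" "p $ 2 - F $ 2 = x * v $ 2 + y * v $ 1"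
    using N by simp_all
  then have "p = F + x *\<^sub>R v + y *\<^sub>R perp v" by (simp add: plane_eq_iff)
  then show ?thesis by (rule that)
qed

lemma conic_neq_UNIV: "\<not> conic UNIV"
proof
  assume "conic UNIV"
  then obtain a b c d e f where nz: "(a, b, c) \<noteq> (0, 0, 0 :: real)"
    and K: "UNIV = {p :: plane. a * (p $ 1)\<^sup>2 + b * (p $ 1) * (p $ 2) + c * (p $ 2)\<^sup>2 +
             d * (p $ 1) + e * (p $ 2) + f = 0}"
    unfolding conic_def by blast
  have q: "a * x\<^sup>2 + b * x * y + c * y\<^sup>2 + d * x + e * y + f = 0" for x y
  proof -
    have "(vector [x, y] :: plane) \<in> UNIV" by simp
    then show ?thesis unfolding K by simp
  qed
  \<comment> \<open>The value at the origin gives \<open>f\<close>, the four values on the axes give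
    \<open>a\<close>, \<open>c\<close>, \<open>d\<close>, \<open>e\<close>, and the value at
    \<open>(1, 1)\<close> then gives \<open>b\<close>.\<close>
  show False
    using nz q[of 0 0] q[of 1 0] q[of "-1" 0] q[of 0 1] q[of 0 "-1"] q[of 1 1] by simp
qed

lemma affine_form_zero_at_noncollinear:
  fixes b c e :: real
  assumes "b * x1 + c * y1 + e = 0" "b * x2 + c * y2 + e = 0" "b * x3 + c * y3 + e = 0"
    and det: "(x2 - x1) * (y3 - y1) - (y2 - y1) * (x3 - x1) \<noteq> 0"
  shows "b = 0 \<and> c = 0 \<and> e = 0"
proof -
  have "b * ((x2 - x1) * (y3 - y1) - (y2 - y1) * (x3 - x1)) = 0"
    "c * ((x2 - x1) * (y3 - y1) - (y2 - y1) * (x3 - x1)) = 0"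
    using assms(1-3) by algebra+
  with det assms(1) show ?thesis by simp
qed

text \<open>A conic containing the line \<open>FB\<close> is \<open>FB\<close> together with a second line, which would have to
  contain \<open>A\<close>, \<open>C\<close> and \<open>G\<close>.\<close>

lemma line_inter_conic:
  assumes K: "conic K" and FB: "F \<noteq> B" "F \<in> K" "B \<in> K"
    and on: "A \<in> K" "C \<in> K" "G \<in> K"
    and off: "cross (B - F) (A - F) \<noteq> 0" "cross (B - F) (C - F) \<noteq> 0" "cross (B - F) (G - F) \<noteq> 0"
    and nc: "cross (C - A) (G - A) \<noteq> 0"
  shows "line_through F B \<inter> K = {F, B}"
proof -
  define v where "v = B - F"
  have v: "v \<noteq> 0" using FB by (simp add: v_def)
  obtain a b c d e f where Keq: "K = {p. a * (p $ 1)\<^sup>2 + b * (p $ 1) * (p $ 2) + c * (p $ 2)\<^sup>2 +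
             d * (p $ 1) + e * (p $ 2) + f = 0}"
    using K unfolding conic_def by blast
  obtain a' b' c' d' e' f' where q: "\<And>x y p. p = F + x *\<^sub>R v + y *\<^sub>R perp v \<Longrightarrow>
    a * (p $ 1)\<^sup>2 + b * (p $ 1) * (p $ 2) + c * (p $ 2)\<^sup>2 + d * (p $ 1) + e * (p $ 2) + f =
    a' * x\<^sup>2 + b' * x * y + c' * y\<^sup>2 + d' * x + e' * y + f'"
    using quadratic_in_rotated_coordinates[of F v a b c d e f] by blast
  have inK: "p \<in> K \<longleftrightarrow> a' * x\<^sup>2 + b' * x * y + c' * y\<^sup>2 + d' * x + e' * y + f' = 0"
    if "p = F + x *\<^sub>R v + y *\<^sub>R perp v" for p x y
    unfolding Keq using q[OF that] by simp
  \<comment> \<open>The points \<open>F\<close> and \<open>B\<close> have coordinates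
    \<open>(0, 0)\<close> and \<open>(1, 0)\<close>, so on the line \<open>FB\<close> the equation
    reduces to \<open>a' * (x\<^sup>2 - x) = 0\<close>.\<close>
  have f': "f' = 0" using inK[of F 0 0] FB by simp
  have d': "d' = - a'" using inK[of B 1 0] FB f' by (simp add: v_def)
  \<comment> \<open>Otherwise the polynomial is \<open>y\<close> times an affine form that vanishes
    at the noncollinear points \<open>A\<close>, \<open>C\<close>, \<open>G\<close>, hence
    identically. Concluding with \<open>K = UNIV\<close> avoids carrying
    \<open>(a, b, c) \<noteq> (0, 0, 0)\<close> through the change of coordinates.\<close>
  have "a' \<noteq> 0"
  proof
    assume a': "a' = 0"
    obtain xA yA where A: "A = F + xA *\<^sub>R v + yA *\<^sub>R perp v" using rotated_coordinates_exist[OF v] .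
    obtain xC yC where C: "C = F + xC *\<^sub>R v + yC *\<^sub>R perp v" using rotated_coordinates_exist[OF v] .
    obtain xG yG where G: "G = F + xG *\<^sub>R v + yG *\<^sub>R perp v" using rotated_coordinates_exist[OF v] .
    have cv: "cross v (F + x *\<^sub>R v + y *\<^sub>R perp v - F) = y * ((v $ 1)\<^sup>2 + (v $ 2)\<^sup>2)" for x y
      by (simp add: cross_def power2_eq_square algebra_simps)
    have "yA \<noteq> 0" "yC \<noteq> 0" "yG \<noteq> 0"
      using off unfolding v_def[symmetric] A C G cv by auto
    have fac: "b' * x + c' * y + e' = 0" if "p = F + x *\<^sub>R v + y *\<^sub>R perp v" "p \<in> K" "y \<noteq> 0" for p x y
    proof -
      have "y * (b' * x + c' * y + e') = 0"
        using inK[OF that(1)] that(2) a' d' f' by (simp add: power2_eq_square algebra_simps)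
      with that(3) show ?thesis by simp
    qed
    have "cross (C - A) (G - A) =
        ((v $ 1)\<^sup>2 + (v $ 2)\<^sup>2) * ((xC - xA) * (yG - yA) - (yC - yA) * (xG - xA))"
      unfolding A C G by (simp add: cross_def power2_eq_square algebra_simps)
    with nc have "(xC - xA) * (yG - yA) - (yC - yA) * (xG - xA) \<noteq> 0" by auto
    with fac[OF A on(1)] fac[OF C on(2)] fac[OF G on(3)] \<open>yA \<noteq> 0\<close> \<open>yC \<noteq> 0\<close> \<open>yG \<noteq> 0\<close>
    have "b' = 0 \<and> c' = 0 \<and> e' = 0"
      by (intro affine_form_zero_at_noncollinear)
    then have "p \<in> K" for p
      using rotated_coordinates_exist[OF v, of p F] inK a' d' f' by (metis add_0 mult_zero_left neg_0_equal_iff_equal)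
    then have "K = UNIV" by blast
    with K conic_neq_UNIV show False by simp
  qed
  show ?thesis
  proof
    show "{F, B} \<subseteq> line_through F B \<inter> K" using FB by (simp add: hull_inc)
    show "line_through F B \<inter> K \<subseteq> {F, B}"
    proof
      fix p assume p: "p \<in> line_through F B \<inter> K"
      then obtain x where x: "p = F + x *\<^sub>R v + 0 *\<^sub>R perp v"
        by (auto simp: in_line_through v_def)
      have "a' * x\<^sup>2 - a' * x = 0" using inK[OF x] p d' f' by simp
      then have "a' * (x * (x - 1)) = 0" by (simp add: power2_eq_square algebra_simps)
      with \<open>a' \<noteq> 0\<close> have "x = 0 \<or> x = 1" by simp
      then show "p \<in> {F, B}" using x by (auto simp: v_def)
    qed
  qed
qed

section \<open>The lines from a Fermat point to the vertices meet the hyperbola\<close>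

text \<open>Both apexes over \<open>CA\<close> lie on its perpendicular bisector, so for
  \<open>c \<noteq> 0\<close> they are collinear with \<open>B\<close> only if \<open>B\<close> is
  equidistant from \<open>A\<close> and \<open>C\<close>.\<close>

lemma cross_opposite_fermat_lines:
  "cross (apex c C A - B) (apex (- c) C A - B) = c * ((dist B C)\<^sup>2 - (dist A B)\<^sup>2)"
proof -
  have dist2: "(dist x y)\<^sup>2 = (x $ 1 - y $ 1)\<^sup>2 + (x $ 2 - y $ 2)\<^sup>2" for x y :: plane
    by (simp add: dist_plane)
  show ?thesis unfolding dist2 by (simp add: cross_def power2_eq_square field_simps)
qed

lemma cross_scaleR: "cross (r *\<^sub>R u) (t *\<^sub>R v) = r * t * cross u v"
  by (simp add: cross_def algebra_simps)

lemma line_through_eqI: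
  assumes "P \<noteq> Q" "P \<noteq> R" "cross (Q - P) (R - P) = 0"
  shows "line_through P Q = line_through P R"
proof -
  obtain t where t: "R - P = t *\<^sub>R (Q - P)"
    using cross_zero_parallel[OF assms(3)] assms(1) by auto
  with assms(2) have "t \<noteq> 0" by auto
  then show ?thesis
    using in_line_through_iff_cross[OF assms(1)] in_line_through_iff_cross[OF assms(2)] t
      cross_scaleR[of t "Q - P" 1]
    by auto
qed

lemma fermat_direction:
  assumes "fermat c A B C F" "F \<noteq> A"
  obtains t where "t \<noteq> 0" "F - A = t *\<^sub>R (apex c B C - A)"
proof -
  obtain t where "F = A + t *\<^sub>R (apex c B C - A)"
    using assms(1) by (auto simp: fermat_def in_line_through)
  with that[of t] assms(2) show ?thesis by auto
qed

text \<open>The vector from \<open>F\<close> to \<open>apex c F A\<close> is \<open>A - F\<close>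
  turned by 60 degrees, which by \<open>fermat_lines_rotation\<close> is parallel to
  \<open>FB\<close>. The other Fermat point \<open>G\<close> shows that \<open>K\<close> does not
  contain this line.\<close>

lemma fermat_line_inter_conic:
  assumes c: "c\<^sup>2 = 3/4" and sc: "scalene A B C" and F: "fermat c A B C F"
    and G: "fermat (- c) A B C G" and K: "conic K" "{A, B, C, F, G} \<subseteq> K"
    and ne: "F \<notin> {A, B, C}" "G \<notin> {A, B, C}"
  shows "line_through F (apex c F A) \<inter> K = {F, B}"
proof -
  define u v w where "u = apex c B C - A" and "v = apex c C A - B" and "w = apex c A B - C"
  define u' v' w' where "u' = apex (-c) B C - A" and "v' = apex (-c) C A - B" and "w' = apex (-c) A B - C"
  have c': "(- c)\<^sup>2 = 3/4" using c by simp
  have uv: "cross u v \<noteq> 0" and vw: "cross v w \<noteq> 0" and wu': "cross w' u' \<noteq> 0"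
    unfolding u_def v_def w_def u'_def w'_def
    using cross_fermat_lines_neq_0[OF c sc] cross_fermat_lines_neq_0[OF c scalene_rotate[OF sc]]
      cross_fermat_lines_neq_0[OF c' scalene_rotate[OF scalene_rotate[OF sc]]] by auto
  have vv': "cross v v' \<noteq> 0"
  proof -
    have "dist A B \<noteq> dist B C" "c \<noteq> 0" using sc c by (auto simp: scalene_def)
    then show ?thesis unfolding v_def v'_def cross_opposite_fermat_lines by simp
  qed
  obtain r where r: "r \<noteq> 0" "F - A = r *\<^sub>R u"
    using fermat_direction[OF F] ne by (auto simp: u_def)
  obtain s where s: "s \<noteq> 0" "F - B = s *\<^sub>R v"
    using fermat_direction[OF fermat_rotate[OF F]] ne by (auto simp: v_def)
  obtain t where t: "t \<noteq> 0" "F - C = t *\<^sub>R w"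
    using fermat_direction[OF fermat_rotate[OF fermat_rotate[OF F]]] ne by (auto simp: w_def)
  obtain r' where r': "r' \<noteq> 0" "G - A = r' *\<^sub>R u'"
    using fermat_direction[OF G] ne by (auto simp: u'_def)
  obtain s' where s': "s' \<noteq> 0" "G - B = s' *\<^sub>R v'"
    using fermat_direction[OF fermat_rotate[OF G]] ne by (auto simp: v'_def)
  obtain t' where t': "t' \<noteq> 0" "G - C = t' *\<^sub>R w'"
    using fermat_direction[OF fermat_rotate[OF fermat_rotate[OF G]]] ne by (auto simp: w'_def)
  have BF: "B - F = (- s) *\<^sub>R v" using s by (simp add: algebra_simps)
  have AF: "A - F = (- r) *\<^sub>R u" using r by (simp add: algebra_simps)
  have v: "v = - ((1/2) *\<^sub>R u + c *\<^sub>R perp u)"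
    unfolding u_def v_def by (rule fermat_lines_rotation[OF c])
  have "apex c F A - F = (1/2) *\<^sub>R (A - F) + c *\<^sub>R perp (A - F)"
    by (simp add: plane_eq_iff field_simps)
  also have "\<dots> = r *\<^sub>R v"
    unfolding AF v by (simp add: plane_eq_iff algebra_simps)
  finally have PF: "apex c F A - F = r *\<^sub>R v" .
  have v0: "v \<noteq> 0" using uv by (auto simp: cross_def)
  have "line_through F (apex c F A) = line_through F B"
  proof (rule line_through_eqI)
    show "F \<noteq> apex c F A" using PF r v0 by auto
    show "F \<noteq> B" using ne by auto
    show "cross (apex c F A - F) (B - F) = 0" unfolding PF BF by (simp add: cross_def)
  qed
  also have "\<dots> \<inter> K = {F, B}"
  proof (rule line_inter_conic[OF K(1)])
    show "F \<noteq> B" using ne by auto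
    show "cross (B - F) (A - F) \<noteq> 0" unfolding BF AF cross_scaleR
      using r s uv by (simp add: cross_def algebra_simps)
    have "C - F = (- t) *\<^sub>R w" using t by (simp add: algebra_simps)
    then show "cross (B - F) (C - F) \<noteq> 0" unfolding BF by (simp only: cross_scaleR) (use t s vw in simp)
    \<comment> \<open>Passing from \<open>G - F\<close> to \<open>G - B\<close> subtracts
      \<open>B - F\<close> and reduces the claim to the two distinct lines from \<open>B\<close> to
      the apexes over \<open>CA\<close>.\<close>
    have "cross (B - F) (G - F) = cross (B - F) (G - B)" by (simp add: cross_def algebra_simps)
    also have "\<dots> \<noteq> 0" unfolding BF s' cross_scaleR using s s' vv' by simp
    finally show "cross (B - F) (G - F) \<noteq> 0" .
    \<comment> \<open>Collinearity of \<open>A\<close>, \<open>C\<close>, \<open>G\<close> is read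
      off at \<open>G\<close>, where the Fermat lines \<open>GA\<close> and \<open>GC\<close> are
      not parallel.\<close>
    have "cross (C - A) (G - A) = - cross (G - C) (G - A)" by (simp add: cross_def algebra_simps)
    also have "\<dots> \<noteq> 0" unfolding r' t' cross_scaleR using r' t' wu' by simp
    finally show "cross (C - A) (G - A) \<noteq> 0" .
  qed (use K(2) in auto)
  finally show ?thesis .
qed

lemma kiepert_line_inters:
  assumes K: "kiepert_hyperbola K A B C"
    and F: "first_fermat_point A B C F \<or> second_fermat_point A B C F"
  obtains c where "c = sqrt 3 / 2 \<or> c = - (sqrt 3 / 2)" "F \<noteq> A" "F \<noteq> B" "F \<noteq> C"
    "line_through F (apex c F A) \<inter> K = {F, B}" "line_through F (apex (- c) F A) \<inter> K = {F, C}"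
proof -
  define D where "D = cross (B - A) (C - A)"
  define k where "k = sgn D * (sqrt 3 / 2)"
  have sc: "scalene A B C" using K by (simp add: kiepert_hyperbola_def)
  then have D: "D \<noteq> 0" by (simp add: D_def scalene_def collinear_iff_cross)
  have k: "k = sqrt 3 / 2 \<or> k = - (sqrt 3 / 2)"
    using D by (auto simp: k_def sgn_if)
  then have "k\<^sup>2 = (sqrt 3 / 2)\<^sup>2" unfolding power2_eq_iff .
  then have k2: "k\<^sup>2 = 3/4" "(- k)\<^sup>2 = 3/4" by (simp_all add: power_divide)
  have first: "fermat (- k) A B C P" if "first_fermat_point A B C P" for P
    using first_fermat_point_imp_fermat[OF _ that] D by (simp add: k_def D_def)
  have second: "fermat k A B C P" if "second_fermat_point A B C P" for P
    using second_fermat_point_imp_fermat[OF _ that] D by (simp add: k_def D_def)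
  obtain F1 F2 where "first_fermat_point A B C F1" "second_fermat_point A B C F2" and Kc: "conic K"
    and sub: "{A, B, C, F1, F2} \<subseteq> K"
    and uniq: "\<forall>K'. conic K' \<and> {A, B, C, F1, F2} \<subseteq> K' \<longrightarrow> K' = K"
    using K unfolding kiepert_hyperbola_def by blast
  then have F12: "fermat (- k) A B C F1" "fermat k A B C F2" using first second by blast+
  \<comment> \<open>If a Fermat point were a vertex, the unique conic would be determined by four
    points.\<close>
  have F1: "F1 \<notin> {A, B, C}"
  proof
    assume "F1 \<in> {A, B, C}"
    then have "{A, B, C, F1, F2} = {A, B, C, F2}" by auto
    with uniq no_unique_conic_through_four_points[of B A C F2 K] D show False by (simp add: D_def)
  qed
  have F2: "F2 \<notin> {A, B, C}"
  proof
    assume "F2 \<in> {A, B, C}"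
    then have "{A, B, C, F1, F2} = {A, B, C, F1}" by auto
    with uniq no_unique_conic_through_four_points[of B A C F1 K] D show False by (simp add: D_def)
  qed
  \<comment> \<open>\<open>G\<close> is the Fermat point other than \<open>F\<close>, and
    \<open>c\<close> is the parameter that belongs to \<open>F\<close>.\<close>
  obtain c G where c: "c = k \<or> c = - k" and FG: "fermat c A B C F" "fermat (- c) A B C G"
    and FGK: "{A, B, C, F, G} \<subseteq> K" and ne: "F \<notin> {A, B, C}" "G \<notin> {A, B, C}"
  proof (cases "first_fermat_point A B C F")
    case True
    then have "F = F1" using fermat_unique[OF k2(2) sc first F12(1)] by simp
    then show ?thesis using that[of "- k" F2] F12 F1 F2 sub by auto
  next
    case False
    then have "F = F2" using fermat_unique[OF k2(1) sc second F12(2)] F by simp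
    then show ?thesis using that[of k F1] F12 F1 F2 sub by auto
  qed
  have c2: "c\<^sup>2 = 3/4" "(- c)\<^sup>2 = 3/4" using c k2 by auto
  show ?thesis
  proof (rule that)
    show "c = sqrt 3 / 2 \<or> c = - (sqrt 3 / 2)" using c k by auto
    show "line_through F (apex c F A) \<inter> K = {F, B}"
      by (rule fermat_line_inter_conic[OF c2(1) sc FG Kc FGK ne])
    \<comment> \<open>The statement for \<open>C\<close> is the one for \<open>B\<close> in the
      triangle with \<open>B\<close> and \<open>C\<close> interchanged, where the parameter is
      \<open>- c\<close>.\<close>
    show "line_through F (apex (- c) F A) \<inter> K = {F, C}"
      by (rule fermat_line_inter_conic[OF c2(2) scalene_swap[OF sc] fermat_swap[OF FG(1)]
            fermat_swap[OF FG(2)] Kc]) (use FGK ne in auto)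
  qed (use ne in auto)
qed

section \<open>The construction with straightedge and compass\<close>

lemma spheres_inter_eq_apices:
  assumes "F \<noteq> A"
  shows "sphere F (dist F A) \<inter> sphere A (dist A F) = {apex (sqrt 3 / 2) F A, apex (- (sqrt 3 / 2)) F A}"
proof -
  have "X \<in> sphere F (dist F A) \<inter> sphere A (dist A F) \<longleftrightarrow>
      dist X F = dist F A \<and> dist X A = dist F A" for X
    by (simp add: dist_commute)
  then show ?thesis unfolding equidistant_iff_apex[OF assms] by blast
qed

lemma apices_distinct:
  assumes "F \<noteq> A"
  shows "apex (sqrt 3 / 2) F A \<noteq> apex (- (sqrt 3 / 2)) F A" "F \<noteq> apex c F A"
proof -
  have "perp (A - F) \<noteq> 0" using assms by (auto simp: plane_eq_iff)
  then show "apex (sqrt 3 / 2) F A \<noteq> apex (- (sqrt 3 / 2)) F A"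
    unfolding apex_def by (simp only: add_left_cancel scaleR_cancel_right) simp
  show "F \<noteq> apex c F A"
  proof
    assume "F = apex c F A"
    then have 0: "(1/2) * (A $ 1 - F $ 1) = c * (A $ 2 - F $ 2)" "(1/2) * (A $ 2 - F $ 2) = - c * (A $ 1 - F $ 1)"
      unfolding plane_eq_iff by (simp_all add: field_simps)
    \<comment> \<open>By the equations \<open>0\<close>, \<open>A - F\<close> is a multiple of its
      own perpendicular, so its squared length is zero.\<close>
    have "(A $ 1 - F $ 1)\<^sup>2 + (A $ 2 - F $ 2)\<^sup>2 =
        2 * ((A $ 1 - F $ 1) * ((1/2) * (A $ 1 - F $ 1)) + (A $ 2 - F $ 2) * ((1/2) * (A $ 2 - F $ 2)))"
      by (simp add: power2_eq_square)
    also have "\<dots> = 0" unfolding 0 by (simp add: algebra_simps)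
    finally show False using sum_squares_plane_pos[of "A - F"] assms by simp
  qed
qed

theorem mainTheorem2:
  "\<exists>(steps :: step list) (i :: nat) (j :: nat).
     \<forall>(K :: plane set) (A :: plane) (B :: plane) (C :: plane) (F :: plane).
       kiepert_hyperbola K A B C \<and> (first_fermat_point A B C F \<or> second_fermat_point A B C F)
       \<longrightarrow> achieves K steps [F, A]
             (\<lambda>ps. i < length ps \<and> j < length ps \<and> {ps ! i, ps ! j} = {B, C})"
proof (intro exI allI impI)
  fix K A B C F
  assume h: "kiepert_hyperbola K A B C \<and> (first_fermat_point A B C F \<or> second_fermat_point A B C F)"
  obtain c where c: "c = sqrt 3 / 2 \<or> c = - (sqrt 3 / 2)"
    and ne: "F \<noteq> A" "F \<noteq> B" "F \<noteq> C"
    and lines: "line_through F (apex c F A) \<inter> K = {F, B}" "line_through F (apex (- c) F A) \<inter> K = {F, C}"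
    by (rule kiepert_line_inters[OF conjunct1[OF h] conjunct2[OF h]])
  define P Q where "P = apex c F A" and "Q = apex (- c) F A"
  have circ: "sphere F (dist F A) \<inter> sphere A (dist A F) = {P, Q}"
    using c unfolding spheres_inter_eq_apices[OF ne(1)] P_def Q_def
    by (elim disjE) (simp_all only: minus_minus insert_commute)
  have "P \<noteq> Q"
    using c apices_distinct(1)[OF ne(1)] unfolding P_def Q_def
    by (elim disjE) (simp_all only: minus_minus simp_thms not_sym[of "apex (sqrt 3 / 2) F A"])
  then have PQ: "P \<noteq> Q" "F \<noteq> P" "F \<noteq> Q"
    using apices_distinct(2)[OF ne(1)] by (simp_all add: P_def Q_def)
  have l: "line_through F P \<inter> K = {F, B}" "line_through F Q \<inter> K = {F, C}"
    using lines by (simp_all add: P_def Q_def)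
  have 1: "{P, Q} - {P} = {Q}" "{P, Q} - {Q} = {P}" "{F, B} - {F} = {B}" "{F, C} - {F} = {C}"
    using PQ ne by auto
  \<comment> \<open>Indices 0 and 1 are \<open>F\<close> and \<open>A\<close>, 2 and 3 the common
    points of the two circles, 4 and 5 the second intersections with \<open>K\<close>. Excluding
    index 2 forces the other circle point, and excluding index 0 discards \<open>F\<close>. Either
    choice in the first step is admissible, so \<open>B\<close> and \<open>C\<close> may come in
    either order.\<close>
  show "achieves K
      [Meet (Circle 0 1) (Circle 1 0) [], Meet (Circle 0 1) (Circle 1 0) [2],
       Meet_Given 0 2 [0], Meet_Given 0 3 [0]] [F, A]
      (\<lambda>ps. 4 < length ps \<and> 5 < length ps \<and> {ps ! 4, ps ! 5} = {B, C})"
    using ne PQ by (auto simp: circ l 1 insert_commute eval_nat_numeral)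
qed

end
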